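(* Let $\varphi$ be a formula of $\mathrm{SMT}_\mathrm{RL}$ over a single string variable $x$, and let $(\mathrm{TS},P) = \textrm{BFA-to-TS}(\textrm{SMT-to-BFA}(\varphi))$. Then for every word $w = \sigma_0\cdots\sigma_{n-1} \in \Sigma^*$, the assignment $x := w$ satisfies $\varphi$ if and only if $w$ is the input sequence of a counterexample to $P$ in $\mathrm{TS}$, i.e. there is a path $v_0,\sigma_0,v_1,\ldots,\sigma_{n-1},v_n$ of $\mathrm{TS}$ with $v_0$ satisfying $I_B$, $(v_k,\sigma_k,v_{k+1})$ satisfying $\Delta_B$ for all $0\le k<n$, and $v_n$ violating $P$. In particular, $\varphi$ is satisfiable iff $P$ is not valid in $\mathrm{TS}$.
   Context: Fix a finite alphabet $\Sigma$. $\mathrm{SMT}_\mathrm{RL}$ is the set of formulas generated by $\varphi ::= \varphi \wedge \varphi \mid \varphi \vee \varphi \mid \neg \varphi \mid x \in L$, where $x$ is a string variable and $L$ is the language of a regular expression over $\Sigma$; the semantics is Boolean logic together with language membership. A Boolean finite automaton (BFA) is a tuple $B = (\Sigma, \tilde Q, \tilde I, \tilde F, \tilde\Delta)$ where $\tilde Q$ is a finite set of state variables, $\tilde I$ is a Boolean formula over $\tilde Q$, $\tilde F : \tilde Q \to \{0,1\}$ is an assignment, and $\tilde\Delta$ assigns to each $q \in \tilde Q$ and $\sigma \in \Sigma$ a Boolean formula $\tilde\Delta(q,\sigma)$ over $\tilde Q$. A word $\sigma_0\cdots\sigma_{n-1}$ is accepted by $B$ iff the formula $G_n$ evaluates to true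 under the assignment $\tilde F$, where $G_0 = \tilde I$ and $G_{k+1}$ is obtained from $G_k$ by simultaneously replacing each $q \in \tilde Q$ by $\tilde\Delta(q,\sigma_k)$. NFA-to-BFA maps an NFA $(\Sigma, Q, I, F, \Delta)$ to the BFA with $\tilde Q = Q$, $\tilde I = \bigvee_{q\in I} q$, $\tilde F$ the indicator of $F$, and $\tilde\Delta(q,\sigma) = \bigvee\{q' : (q,\sigma,q')\in\Delta\}$. Re-to-NFA is the standard Thompson construction from a regular expression to an NFA with $\epsilon$-transitions, followed by $\epsilon$-elimination. BFA operations: for BFAs with disjoint state sets, $B_1 \cup B_2$ (resp. $B_1\cap B_2$) has state set $\tilde Q_1 \uplus \tilde Q_2$, final assignment and transition function the disjoint unions of those of $B_1,B_2$, and initial formula $\tilde I_1 \vee \tilde I_2$ (resp. $\tilde I_1 \wedge \tilde I_2$); $B^\complement$ is $B$ with initial formula $\neg\tilde I$. SMT-to-BFA rewrites $\varphi$ recursively into a single BFA: $x\in L \mapsto$ NFA-to-BFA(Re-to-NFA($L$)), $\wedge \mapsto \cap$, $\vee\mapsto\cup$, $\neg \mapsto {}^\complement$. A finite-state transition system consists of Boolean state bits, Boolean input bits encoding symbols of $\Sigma$, an initial-state formula $I_B$ over the state bits, and a transition formula $\Delta_B$ over current state bits, input symbol and next-state bits; a property $P$ is a formula over state bits, and $P$ is valid if no path from a state satisfying $I_B$ reaches a state violating $P$. BFA-to-TS maps a BFA $(\Sigma,\tilde Q,\tilde I,\tilde F,\tilde\Delta)$ to the transition system with one state bit $b_q$ per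 $q\in\tilde Q$, $I_B = \tilde I[q\mapsto b_q]$, transition relation $\bigwedge_{q\in\tilde Q} \big( b_q = \bigvee_{\sigma\in\Sigma} (x=\sigma \wedge \tilde\Delta(q,\sigma)[q'\mapsto b'_{q'}])\big)$ (where $b'$ are next-state bits and $x$ the current input symbol), and property $P = \bigvee_{\tilde F(q)=1}\neg b_q \vee \bigvee_{\tilde F(q)=0} b_q$ (so $P$ is violated exactly at the state equal to $\tilde F$). *)

theory Defs
  imports Main
begin

datatype 'a rexp = Zero | One | Atom 'a | Plus "'a rexp" "'a rexp"
  | Times "'a rexp" "'a rexp" | Star "'a rexp"

definition conc :: "'a list set \<Rightarrow> 'a list set \<Rightarrow> 'a list set" where
  "conc A B = {u @ v | u v. u \<in> A \<and> v \<in> B}"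

inductive_set kstar :: "'a list set \<Rightarrow> 'a list set" for A where
  kstar_Nil: "[] \<in> kstar A"
| kstar_app: "u \<in> A \<Longrightarrow> v \<in> kstar A \<Longrightarrow> u @ v \<in> kstar A"

fun lang :: "'a rexp \<Rightarrow> 'a list set" where
  "lang Zero = {}"
| "lang One = {[]}"
| "lang (Atom a) = {[a]}"
| "lang (Plus r s) = lang r \<union> lang s"
| "lang (Times r s) = conc (lang r) (lang s)"
| "lang (Star r) = kstar (lang r)"

datatype 'a smt = SAnd "'a smt" "'a smt" | SOr "'a smt" "'a smt" | SNot "'a smt"
  | InRe "'a rexp"

fun smt_sat :: "'a smt \<Rightarrow> 'a list \<Rightarrow> bool" where
  "smt_sat (SAnd p q) w = (smt_sat p w \<and> smt_sat q w)"
| "smt_sat (SOr p q) w = (smt_sat p w \<or> smt_sat q w)"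
| "smt_sat (SNot p) w = (\<not> smt_sat p w)"
| "smt_sat (InRe r) w = (w \<in> lang r)"

datatype 'v bexp = BVar 'v | BTrue | BFalse | BNot "'v bexp"
  | BAnd "'v bexp" "'v bexp" | BOr "'v bexp" "'v bexp"

fun beval :: "('v \<Rightarrow> bool) \<Rightarrow> 'v bexp \<Rightarrow> bool" where
  "beval v (BVar x) = v x"
| "beval v BTrue = True"
| "beval v BFalse = False"
| "beval v (BNot p) = (\<not> beval v p)"
| "beval v (BAnd p q) = (beval v p \<and> beval v q)"
| "beval v (BOr p q) = (beval v p \<or> beval v q)"

definition bdisj :: "'v::linorder set \<Rightarrow> 'v bexp" where
  "bdisj S = foldr (\<lambda>q f. BOr (BVar q) f) (sorted_list_of_set S) BFalse"

text \<open>epsilon-NFA produced by Thompson's construction (None = epsilon)\<close>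
record 'a enfa =
  e_states :: "nat set"
  e_init :: nat
  e_final :: nat
  e_trans :: "(nat \<times> 'a option \<times> nat) set"

record ('s, 'a) nfa =
  n_states :: "'s set"
  n_init :: "'s set"
  n_final :: "'s set"
  n_trans :: "('s \<times> 'a \<times> 's) set"

text \<open>Thompson construction; the second argument is the next fresh state,
  the second result the next fresh state after construction.\<close>
fun thompson :: "'a rexp \<Rightarrow> nat \<Rightarrow> 'a enfa \<times> nat" where
  "thompson Zero n =
     (\<lparr>e_states = {n, n+1}, e_init = n, e_final = n+1, e_trans = {}\<rparr>, n+2)"
| "thompson One n =
     (\<lparr>e_states = {n, n+1}, e_init = n, e_final = n+1, e_trans = {(n, None, n+1)}\<rparr>, n+2)"
| "thompson (Atom a) n =
     (\<lparr>e_states = {n, n+1}, e_init = n, e_final = n+1, e_trans = {(n, Some a, n+1)}\<rparr>, n+2)"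
| "thompson (Plus r s) n =
     (let (A, m) = thompson r (n+2); (B, k) = thompson s m in
      (\<lparr>e_states = {n, n+1} \<union> e_states A \<union> e_states B, e_init = n, e_final = n+1,
        e_trans = e_trans A \<union> e_trans B \<union>
          {(n, None, e_init A), (n, None, e_init B),
           (e_final A, None, n+1), (e_final B, None, n+1)}\<rparr>, k))"
| "thompson (Times r s) n =
     (let (A, m) = thompson r n; (B, k) = thompson s m in
      (\<lparr>e_states = e_states A \<union> e_states B, e_init = e_init A, e_final = e_final B,
        e_trans = e_trans A \<union> e_trans B \<union> {(e_final A, None, e_init B)}\<rparr>, k))"
| "thompson (Star r) n =
     (let (A, m) = thompson r (n+2) in
      (\<lparr>e_states = {n, n+1} \<union> e_states A, e_init = n, e_final = n+1,
        e_trans = e_trans A \<union>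
          {(n, None, e_init A), (n, None, n+1),
           (e_final A, None, e_init A), (e_final A, None, n+1)}\<rparr>, m))"

definition eps_rel :: "'a enfa \<Rightarrow> (nat \<times> nat) set" where
  "eps_rel A = {(p, q). (p, None, q) \<in> e_trans A}"

definition eps_elim :: "'a enfa \<Rightarrow> (nat, 'a) nfa" where
  "eps_elim A =
     \<lparr>n_states = e_states A,
      n_init = {e_init A},
      n_final = {q \<in> e_states A. (q, e_final A) \<in> (eps_rel A)\<^sup>*},
      n_trans = {(q, \<sigma>, q'). \<exists>p. (q, p) \<in> (eps_rel A)\<^sup>* \<and> (p, Some \<sigma>, q') \<in> e_trans A}\<rparr>"

definition re_to_nfa :: "'a rexp \<Rightarrow> (nat, 'a) nfa" where
  "re_to_nfa r = eps_elim (fst (thompson r 0))"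

record ('q, 'a) bfa =
  b_states :: "'q set"
  b_init :: "'q bexp"
  b_fin :: "'q \<Rightarrow> bool"
  b_trans :: "'q \<Rightarrow> 'a \<Rightarrow> 'q bexp"

definition nfa_to_bfa :: "(nat, 'a) nfa \<Rightarrow> (nat, 'a) bfa" where
  "nfa_to_bfa N =
     \<lparr>b_states = n_states N,
      b_init = bdisj (n_init N),
      b_fin = (\<lambda>q. q \<in> n_final N),
      b_trans = (\<lambda>q \<sigma>. bdisj {q'. (q, \<sigma>, q') \<in> n_trans N})\<rparr>"

text \<open>State names for composed BFAs: disjoint unions realised by tagging.\<close>
datatype sloc = Base nat | InL sloc | InR sloc

definition bfa_lift :: "(nat, 'a) bfa \<Rightarrow> (sloc, 'a) bfa" where
  "bfa_lift B =
     \<lparr>b_states = Base ` b_states B,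
      b_init = map_bexp Base (b_init B),
      b_fin = (\<lambda>q. case q of Base n \<Rightarrow> b_fin B n | _ \<Rightarrow> False),
      b_trans = (\<lambda>q \<sigma>. case q of Base n \<Rightarrow> map_bexp Base (b_trans B n \<sigma>) | _ \<Rightarrow> BFalse)\<rparr>"

definition bfa_dunion :: "(sloc, 'a) bfa \<Rightarrow> (sloc, 'a) bfa \<Rightarrow> sloc bexp \<Rightarrow> (sloc, 'a) bfa" where
  "bfa_dunion B1 B2 I =
     \<lparr>b_states = InL ` b_states B1 \<union> InR ` b_states B2,
      b_init = I,
      b_fin = (\<lambda>q. case q of InL p \<Rightarrow> b_fin B1 p | InR p \<Rightarrow> b_fin B2 p | Base _ \<Rightarrow> False),
      b_trans = (\<lambda>q \<sigma>. case q of InL p \<Rightarrow> map_bexp InL (b_trans B1 p \<sigma>)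
                                | InR p \<Rightarrow> map_bexp InR (b_trans B2 p \<sigma>)
                                | Base _ \<Rightarrow> BFalse)\<rparr>"

definition bfa_union :: "(sloc, 'a) bfa \<Rightarrow> (sloc, 'a) bfa \<Rightarrow> (sloc, 'a) bfa" where
  "bfa_union B1 B2 = bfa_dunion B1 B2
     (BOr (map_bexp InL (b_init B1)) (map_bexp InR (b_init B2)))"

definition bfa_inter :: "(sloc, 'a) bfa \<Rightarrow> (sloc, 'a) bfa \<Rightarrow> (sloc, 'a) bfa" where
  "bfa_inter B1 B2 = bfa_dunion B1 B2
     (BAnd (map_bexp InL (b_init B1)) (map_bexp InR (b_init B2)))"

definition bfa_compl :: "(sloc, 'a) bfa \<Rightarrow> (sloc, 'a) bfa" where
  "bfa_compl B = B\<lparr>b_init := BNot (b_init B)\<rparr>"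

fun smt_to_bfa :: "'a smt \<Rightarrow> (sloc, 'a) bfa" where
  "smt_to_bfa (InRe r) = bfa_lift (nfa_to_bfa (re_to_nfa r))"
| "smt_to_bfa (SAnd p q) = bfa_inter (smt_to_bfa p) (smt_to_bfa q)"
| "smt_to_bfa (SOr p q) = bfa_union (smt_to_bfa p) (smt_to_bfa q)"
| "smt_to_bfa (SNot p) = bfa_compl (smt_to_bfa p)"

text \<open>A state is an assignment to the state bits (bits outside ts_bits are fixed to False).\<close>
record ('q, 'a) ts =
  ts_bits :: "'q set"
  ts_init :: "('q \<Rightarrow> bool) \<Rightarrow> bool"
  ts_trans :: "('q \<Rightarrow> bool) \<Rightarrow> 'a \<Rightarrow> ('q \<Rightarrow> bool) \<Rightarrow> bool"

definition ts_state :: "('q, 'a) ts \<Rightarrow> ('q \<Rightarrow> bool) \<Rightarrow> bool" where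
  "ts_state T v = (\<forall>q. q \<notin> ts_bits T \<longrightarrow> \<not> v q)"

definition bfa_to_ts :: "('q, 'a) bfa \<Rightarrow> ('q, 'a) ts \<times> (('q \<Rightarrow> bool) \<Rightarrow> bool)" where
  "bfa_to_ts B =
     (\<lparr>ts_bits = b_states B,
       ts_init = (\<lambda>v. beval v (b_init B)),
       ts_trans = (\<lambda>v x v'. \<forall>q \<in> b_states B.
          v q = (\<exists>\<sigma>. x = \<sigma> \<and> beval v' (b_trans B q \<sigma>)))\<rparr>,
      (\<lambda>v. (\<exists>q \<in> b_states B. b_fin B q \<and> \<not> v q) \<or> (\<exists>q \<in> b_states B. \<not> b_fin B q \<and> v q)))"

definition ts_path :: "('q, 'a) ts \<Rightarrow> 'a list \<Rightarrow> (nat \<Rightarrow> 'q \<Rightarrow> bool) \<Rightarrow> bool" where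
  "ts_path T w vs =
     ((\<forall>k \<le> length w. ts_state T (vs k)) \<and> ts_init T (vs 0) \<and>
      (\<forall>k < length w. ts_trans T (vs k) (w ! k) (vs (Suc k))))"

definition is_cex :: "('q, 'a) ts \<Rightarrow> (('q \<Rightarrow> bool) \<Rightarrow> bool) \<Rightarrow> 'a list \<Rightarrow> bool" where
  "is_cex T P w = (\<exists>vs. ts_path T w vs \<and> \<not> P (vs (length w)))"

definition ts_valid :: "('q, 'a) ts \<Rightarrow> (('q \<Rightarrow> bool) \<Rightarrow> bool) \<Rightarrow> bool" where
  "ts_valid T P = (\<forall>w vs. ts_path T w vs \<longrightarrow> P (vs (length w)))"

end

theory Submission
  imports Defs
begin

text \<open>
  Every stage of the pipeline preserves acceptance. In a Thompson automaton the sub-automata occupy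
  disjoint state ranges and final states are sinks, so a path that starts in a sub-automaton can
  only leave it by the \<open>\<epsilon>\<close>-edge out of its final state; cutting paths at these exits
  computes the language of each construction. \<open>\<epsilon>\<close>-elimination preserves acceptance from
  every state, and the BFA of an NFA assigns to each state whether the NFA accepts the rest of the
  word from it; the Boolean connectives only act on the initial formulas. Finally, the transition
  relation of the system determines every state bit from the next state and the input, so a path
  that ends in the unique violating state (the final assignment) is forced to be the sequence of
  BFA valuations, and it starts in an initial state exactly when the BFA accepts.
\<close>

section \<open>Labelled paths in \<open>\<epsilon>\<close>-automata\<close>

fun label_word :: "'a option \<Rightarrow> 'a list" where
  "label_word None = []"
| "label_word (Some a) = [a]"

lemma label_word_eq_Nil_iff [simp]: "label_word l = [] \<longleftrightarrow> l = None"
  by (cases l) auto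

inductive steps :: "(nat \<times> 'a option \<times> nat) set \<Rightarrow> nat \<Rightarrow> 'a list \<Rightarrow> nat \<Rightarrow> bool"
  for T where
  steps_refl: "steps T p [] p"
| steps_step: "(p, l, p') \<in> T \<Longrightarrow> steps T p' w q \<Longrightarrow> steps T p (label_word l @ w) q"

lemma steps_edge: "(p, l, q) \<in> T \<Longrightarrow> steps T p (label_word l) q"
  using steps_step[OF _ steps_refl] by fastforce

lemma steps_trans: "steps T p u q \<Longrightarrow> steps T q v s \<Longrightarrow> steps T p (u @ v) s"
  by (induction rule: steps.induct) (auto intro: steps.intros)

lemma steps_mono: "steps T p w q \<Longrightarrow> T \<subseteq> T' \<Longrightarrow> steps T' p w q"
  by (induction rule: steps.induct) (auto intro: steps.intros)

lemma steps_from_sink: "steps T p w q \<Longrightarrow> (\<And>l t. (p, l, t) \<notin> T) \<Longrightarrow> w = [] \<and> q = p"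
  by (cases rule: steps.cases) auto

lemma steps_first_edge: "steps T p w q \<Longrightarrow> p \<noteq> q \<Longrightarrow>
   \<exists>l p' w'. (p, l, p') \<in> T \<and> steps T p' w' q \<and> w = label_word l @ w'"
  by (cases rule: steps.cases) auto

lemma steps_single_edge:
  assumes "p \<noteq> q"
  shows "steps {(p, l, q)} p w q \<longleftrightarrow> w = label_word l"
proof
  assume "steps {(p, l, q)} p w q"
  then obtain w' where "steps {(p, l, q)} q w' q" "w = label_word l @ w'"
    using steps_first_edge assms by fastforce
  moreover have "w' = []"
    using steps_from_sink[OF calculation(1)] assms by blast
  ultimately show "w = label_word l"
    by simp
qed (simp add: steps_edge)

lemma steps_via_eps_edges:
  assumes "(p, None, i) \<in> T" "steps T i w f" "(f, None, q) \<in> T"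
  shows "steps T p w q"
  using steps_trans[OF steps_trans[OF steps_edge[OF assms(1)] assms(2)] steps_edge[OF assms(3)]]
  by simp

lemma steps_Nil_iff: "steps T p [] q \<longleftrightarrow> (p, q) \<in> {(a, b). (a, None, b) \<in> T}\<^sup>*"
proof
  have "(p, q) \<in> {(a, b). (a, None, b) \<in> T}\<^sup>*" if "steps T p w q" "w = []" for w
    using that by (induction rule: steps.induct) (auto intro: converse_rtrancl_into_rtrancl)
  then show "steps T p [] q \<Longrightarrow> (p, q) \<in> {(a, b). (a, None, b) \<in> T}\<^sup>*"
    by blast
next
  show "(p, q) \<in> {(a, b). (a, None, b) \<in> T}\<^sup>* \<Longrightarrow> steps T p [] q"
  proof (induction rule: converse_rtrancl_induct)
    case (step y z)
    then show ?case
      using steps_step[of y None z T "[]" q] by simp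
  qed (rule steps_refl)
qed

lemma steps_Cons_iff:
  "steps T p (\<sigma> # w) q \<longleftrightarrow>
     (\<exists>p' p''. (p, p') \<in> {(a, b). (a, None, b) \<in> T}\<^sup>* \<and> (p', Some \<sigma>, p'') \<in> T \<and> steps T p'' w q)"
proof
  have "\<exists>p' p''. (p, p') \<in> {(a, b). (a, None, b) \<in> T}\<^sup>* \<and> (p', Some \<sigma>, p'') \<in> T \<and> steps T p'' w q"
    if "steps T p v q" "v = \<sigma> # w" for v
    using that
  proof (induction rule: steps.induct)
    case (steps_step p l p' v q)
    then show ?case
      by (cases l) (auto intro: converse_rtrancl_into_rtrancl)
  qed simp
  then show "steps T p (\<sigma> # w) q \<Longrightarrow> ?this" for this
    by blast
next
  assume "\<exists>p' p''. (p, p') \<in> {(a, b). (a, None, b) \<in> T}\<^sup>* \<and> (p', Some \<sigma>, p'') \<in> T \<and> steps T p'' w q"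
  then obtain p' p'' where "steps T p [] p'" "steps T p' [\<sigma>] p''" "steps T p'' w q"
    using steps_Nil_iff steps_edge by fastforce
  from steps_trans[OF this(1) steps_trans[OF this(2,3)]] show "steps T p (\<sigma> # w) q"
    by simp
qed

lemma steps_stay_in_region:
  assumes "steps T p w q" "p \<in> S"
    and "\<And>s l t. (s, l, t) \<in> T \<Longrightarrow> s \<in> S \<Longrightarrow> (s, l, t) \<in> E"
    and "\<And>s l t. (s, l, t) \<in> E \<Longrightarrow> t \<in> S"
  shows "steps E p w q"
  using assms(1,2) by (induction rule: steps.induct) (auto intro: steps.intros assms(3,4))

lemma steps_leave_region:
  assumes "steps T p w q" "p \<in> S" "q \<notin> S"
    and "\<And>s l t. (s, l, t) \<in> T \<Longrightarrow> s \<in> S \<Longrightarrow> (s, l, t) \<in> E \<or> (s, l, t) = (f, None, t\<^sub>0)"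
    and "\<And>s l t. (s, l, t) \<in> E \<Longrightarrow> t \<in> S"
  shows "\<exists>u v. w = u @ v \<and> steps E p u f \<and> steps T t\<^sub>0 v q"
  using assms(1-3)
proof (induction rule: steps.induct)
  case (steps_step p l p' w q)
  from assms(4)[OF steps_step.hyps(1) steps_step.prems(1)] show ?case
  proof
    assume edge: "(p, l, p') \<in> E"
    then obtain u v where "w = u @ v" "steps E p' u f" "steps T t\<^sub>0 v q"
      using steps_step assms(5) by blast
    then show ?case using edge by (metis append.assoc steps.steps_step)
  next
    assume "(p, l, p') = (f, None, t\<^sub>0)"
    then show ?case using steps_step.hyps(2) by (auto intro: steps_refl)
  qed
qed simp

lemma steps_loop_decompose:
  assumes "steps (insert (f, None, i) T) p w f"
  shows "\<exists>u v. w = u @ v \<and> steps T p u f \<and> v \<in> kstar {x. steps T i x f}"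
proof -
  have "\<exists>u v. w = u @ v \<and> steps T p u f \<and> v \<in> kstar {x. steps T i x f}"
    if "steps T' p w q" "T' = insert (f, None, i) T" "q = f" for T' p w q
    using that
  proof (induction rule: steps.induct)
    case (steps_refl p)
    then show ?case by (auto intro: steps.intros kstar.intros)
  next
    case (steps_step p l p' w q)
    then obtain u v where uv: "w = u @ v" "steps T p' u f" "v \<in> kstar {x. steps T i x f}"
      by blast
    show ?case
    proof (cases "(p, l, p') \<in> T")
      case True
      then show ?thesis using uv by (metis append.assoc steps.steps_step)
    next
      case False
      then have "p = f" "l = None" "p' = i" using steps_step by auto
      then show ?thesis using uv by (metis append_Nil label_word.simps(1) kstar_app mem_Collect_eq steps_refl)
    qed
  qed
  then show ?thesis using assms by blast
qed

section \<open>Thompson's construction\<close>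

definition enfa_lang :: "'a enfa \<Rightarrow> 'a list set" where
  "enfa_lang A = {w. steps (e_trans A) (e_init A) w (e_final A)}"

definition enfa_plus :: "nat \<Rightarrow> 'a enfa \<Rightarrow> 'a enfa \<Rightarrow> 'a enfa" where
  "enfa_plus n A B =
     \<lparr>e_states = {n, n+1} \<union> e_states A \<union> e_states B, e_init = n, e_final = n+1,
      e_trans = e_trans A \<union> e_trans B \<union>
        {(n, None, e_init A), (n, None, e_init B),
         (e_final A, None, n+1), (e_final B, None, n+1)}\<rparr>"

definition enfa_times :: "'a enfa \<Rightarrow> 'a enfa \<Rightarrow> 'a enfa" where
  "enfa_times A B =
     \<lparr>e_states = e_states A \<union> e_states B, e_init = e_init A, e_final = e_final B,
      e_trans = e_trans A \<union> e_trans B \<union> {(e_final A, None, e_init B)}\<rparr>"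

definition enfa_star :: "nat \<Rightarrow> 'a enfa \<Rightarrow> 'a enfa" where
  "enfa_star n A =
     \<lparr>e_states = {n, n+1} \<union> e_states A, e_init = n, e_final = n+1,
      e_trans = e_trans A \<union>
        {(n, None, e_init A), (n, None, n+1),
         (e_final A, None, e_init A), (e_final A, None, n+1)}\<rparr>"

lemma thompson_Plus_eq:
  "thompson r (n+2) = (A, m) \<Longrightarrow> thompson s m = (B, k) \<Longrightarrow>
   thompson (Plus r s) n = (enfa_plus n A B, k)"
  by (simp add: enfa_plus_def)

lemma thompson_Times_eq:
  "thompson r n = (A, m) \<Longrightarrow> thompson s m = (B, k) \<Longrightarrow>
   thompson (Times r s) n = (enfa_times A B, k)"
  by (simp add: enfa_times_def)

lemma thompson_Star_eq:
  "thompson r (n+2) = (A, m) \<Longrightarrow> thompson (Star r) n = (enfa_star n A, m)"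
  by (simp add: enfa_star_def)

definition wf_enfa :: "'a enfa \<Rightarrow> bool" where
  "wf_enfa A \<longleftrightarrow> e_init A \<in> e_states A \<and> e_final A \<in> e_states A \<and> finite (e_trans A) \<and>
     (\<forall>p l q. (p, l, q) \<in> e_trans A \<longrightarrow> p \<in> e_states A \<and> q \<in> e_states A \<and> p \<noteq> e_final A)"

lemma wf_enfa_plus:
  assumes "wf_enfa A" "wf_enfa B" "n+1 \<notin> e_states A \<union> e_states B"
  shows "wf_enfa (enfa_plus n A B)"
  using assms unfolding wf_enfa_def enfa_plus_def by auto

lemma wf_enfa_times:
  assumes "wf_enfa A" "wf_enfa B" "e_states A \<inter> e_states B = {}"
  shows "wf_enfa (enfa_times A B)"
  using assms unfolding wf_enfa_def enfa_times_def by auto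

lemma wf_enfa_star:
  assumes "wf_enfa A" "n+1 \<notin> e_states A"
  shows "wf_enfa (enfa_star n A)"
  using assms unfolding wf_enfa_def enfa_star_def by auto

lemma thompson_wf: "thompson r n = (A, m) \<Longrightarrow> wf_enfa A \<and> e_states A \<subseteq> {n..<m}"
proof (induction r arbitrary: n A m)
  case (Plus r s)
  obtain A1 m1 B1 k where a: "thompson r (n+2) = (A1, m1)" and b: "thompson s m1 = (B1, k)"
    by (metis surj_pair)
  have wf: "wf_enfa A1" "wf_enfa B1"
    and range: "e_states A1 \<subseteq> {n+2..<m1}" "e_states B1 \<subseteq> {m1..<k}"
    using Plus.IH a b by auto
  have "n + 2 < m1" "m1 < k"
    using wf range unfolding wf_enfa_def by fastforce+
  then have "n+1 \<notin> e_states A1 \<union> e_states B1" "e_states (enfa_plus n A1 B1) \<subseteq> {n..<k}"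
    using range by (auto simp: enfa_plus_def)
  moreover have "A = enfa_plus n A1 B1" "m = k"
    using thompson_Plus_eq[OF a b] Plus.prems by simp_all
  ultimately show ?case
    using wf_enfa_plus[OF wf] by simp
next
  case (Times r s)
  obtain A1 m1 B1 k where a: "thompson r n = (A1, m1)" and b: "thompson s m1 = (B1, k)"
    by (metis surj_pair)
  have wf: "wf_enfa A1" "wf_enfa B1"
    and range: "e_states A1 \<subseteq> {n..<m1}" "e_states B1 \<subseteq> {m1..<k}"
    using Times.IH a b by auto
  have "n < m1" "m1 < k"
    using wf range unfolding wf_enfa_def by fastforce+
  then have "e_states A1 \<inter> e_states B1 = {}" "e_states (enfa_times A1 B1) \<subseteq> {n..<k}"
    using range by (fastforce simp: enfa_times_def)+
  moreover have "A = enfa_times A1 B1" "m = k"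
    using thompson_Times_eq[OF a b] Times.prems by simp_all
  ultimately show ?case
    using wf_enfa_times[OF wf] by simp
next
  case (Star r)
  obtain A1 m1 where a: "thompson r (n+2) = (A1, m1)"
    by (metis surj_pair)
  have wf: "wf_enfa A1" and range: "e_states A1 \<subseteq> {n+2..<m1}"
    using Star.IH a by auto
  have "n + 2 < m1"
    using wf range unfolding wf_enfa_def by fastforce
  then have "n+1 \<notin> e_states A1" "e_states (enfa_star n A1) \<subseteq> {n..<m1}"
    using range by (auto simp: enfa_star_def)
  moreover have "A = enfa_star n A1" "m = m1"
    using thompson_Star_eq[OF a] Star.prems by simp_all
  ultimately show ?case
    using wf_enfa_star[OF wf] by simp
qed (auto simp: wf_enfa_def)

lemma thompson_states_range:
  "thompson r n = (A, m) \<Longrightarrow> n < m \<and> (\<forall>q \<in> e_states A. n \<le> q \<and> q < m)"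
  using thompson_wf[of r n A m] by (fastforce simp: wf_enfa_def)

lemma enfa_plus_trans_commute: "e_trans (enfa_plus n B A) = e_trans (enfa_plus n A B)"
  by (auto simp: enfa_plus_def)

lemma steps_enfa_plus_branch:
  assumes "wf_enfa A" "wf_enfa B" "e_states A \<inter> e_states B = {}"
    "n \<notin> e_states A \<union> e_states B" "n+1 \<notin> e_states A \<union> e_states B"
    and path: "steps (e_trans (enfa_plus n A B)) (e_init A) w (n+1)"
  shows "w \<in> enfa_lang A"
proof -
  let ?T = "e_trans (enfa_plus n A B)"
  have "\<exists>u v. w = u @ v \<and> steps (e_trans A) (e_init A) u (e_final A) \<and> steps ?T (n+1) v (n+1)"
    by (rule steps_leave_region[OF path, where S = "e_states A"])
      (use assms in \<open>auto simp: wf_enfa_def enfa_plus_def\<close>)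
  moreover have "(n+1, l, t) \<notin> ?T" for l t
    using assms(1-5) by (auto simp: wf_enfa_def enfa_plus_def)
  ultimately show ?thesis
    using steps_from_sink unfolding enfa_lang_def by fastforce
qed

lemma enfa_lang_plus:
  assumes "wf_enfa A" "wf_enfa B" "e_states A \<inter> e_states B = {}"
    "n \<notin> e_states A \<union> e_states B" "n+1 \<notin> e_states A \<union> e_states B"
  shows "enfa_lang (enfa_plus n A B) = enfa_lang A \<union> enfa_lang B"
proof
  let ?T = "e_trans (enfa_plus n A B)"
  show "enfa_lang (enfa_plus n A B) \<subseteq> enfa_lang A \<union> enfa_lang B"
  proof
    fix w assume "w \<in> enfa_lang (enfa_plus n A B)"
    then have "steps ?T n w (n+1)"
      by (simp add: enfa_lang_def enfa_plus_def)
    then obtain l p w' where edge: "(n, l, p) \<in> ?T" and rest: "steps ?T p w' (n+1)"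
      and w: "w = label_word l @ w'"
      using steps_first_edge by fastforce
    from edge assms have "l = None" "p = e_init A \<or> p = e_init B"
      by (auto simp: wf_enfa_def enfa_plus_def)
    moreover have "w' \<in> enfa_lang B" if "p = e_init B"
      using steps_enfa_plus_branch[of B A n] assms rest that
      by (simp add: enfa_plus_trans_commute Int_commute Un_commute)
    ultimately show "w \<in> enfa_lang A \<union> enfa_lang B"
      using steps_enfa_plus_branch[OF assms] rest w by auto
  qed
  have "steps ?T n w (n+1)" if "C \<in> {A, B}" "w \<in> enfa_lang C" for C w
  proof (rule steps_via_eps_edges)
    show "(n, None, e_init C) \<in> ?T" "(e_final C, None, n+1) \<in> ?T"
      using that(1) by (auto simp: enfa_plus_def)
    show "steps ?T (e_init C) w (e_final C)"
      using that steps_mono[of "e_trans C" _ w _ ?T] by (auto simp: enfa_lang_def enfa_plus_def)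
  qed
  then show "enfa_lang A \<union> enfa_lang B \<subseteq> enfa_lang (enfa_plus n A B)"
    by (auto simp: enfa_lang_def enfa_plus_def)
qed

lemma enfa_lang_times:
  assumes "wf_enfa A" "wf_enfa B" "e_states A \<inter> e_states B = {}"
  shows "enfa_lang (enfa_times A B) = conc (enfa_lang A) (enfa_lang B)"
proof
  let ?T = "e_trans (enfa_times A B)"
  show "enfa_lang (enfa_times A B) \<subseteq> conc (enfa_lang A) (enfa_lang B)"
  proof
    fix w assume "w \<in> enfa_lang (enfa_times A B)"
    then have path: "steps ?T (e_init A) w (e_final B)"
      by (simp add: enfa_lang_def enfa_times_def)
    have "\<exists>u v. w = u @ v \<and> steps (e_trans A) (e_init A) u (e_final A) \<and> steps ?T (e_init B) v (e_final B)"
      by (rule steps_leave_region[OF path, where S = "e_states A"])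
        (use assms in \<open>auto simp: wf_enfa_def enfa_times_def\<close>)
    then obtain u v where "w = u @ v" "u \<in> enfa_lang A" and second: "steps ?T (e_init B) v (e_final B)"
      unfolding enfa_lang_def by blast
    moreover have "steps (e_trans B) (e_init B) v (e_final B)"
      by (rule steps_stay_in_region[OF second, where S = "e_states B"])
        (use assms in \<open>auto simp: wf_enfa_def enfa_times_def\<close>)
    ultimately show "w \<in> conc (enfa_lang A) (enfa_lang B)"
      by (auto simp: conc_def enfa_lang_def)
  qed
  show "conc (enfa_lang A) (enfa_lang B) \<subseteq> enfa_lang (enfa_times A B)"
  proof
    fix w assume "w \<in> conc (enfa_lang A) (enfa_lang B)"
    then obtain u v where "w = u @ v" "u \<in> enfa_lang A" "v \<in> enfa_lang B"
      by (auto simp: conc_def)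
    then have first: "steps ?T (e_init A) u (e_final A)" and second: "steps ?T (e_init B) v (e_final B)"
      by (auto simp: enfa_lang_def enfa_times_def elim: steps_mono)
    have link: "steps ?T (e_final A) [] (e_init B)"
      using steps_edge[of "e_final A" None "e_init B" ?T] by (simp add: enfa_times_def)
    show "w \<in> enfa_lang (enfa_times A B)"
      using steps_trans[OF first steps_trans[OF link second]] \<open>w = u @ v\<close>
      by (simp add: enfa_lang_def enfa_times_def)
  qed
qed

lemma enfa_lang_star:
  assumes "wf_enfa A" "n \<notin> e_states A" "n+1 \<notin> e_states A"
  shows "enfa_lang (enfa_star n A) = kstar (enfa_lang A)"
proof
  let ?T = "e_trans (enfa_star n A)"
  have sink: "(n+1, l, t) \<notin> ?T" for l t
    using assms by (auto simp: wf_enfa_def enfa_star_def)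
  show "enfa_lang (enfa_star n A) \<subseteq> kstar (enfa_lang A)"
  proof
    fix w assume "w \<in> enfa_lang (enfa_star n A)"
    then have "steps ?T n w (n+1)"
      by (simp add: enfa_lang_def enfa_star_def)
    then obtain l p w' where edge: "(n, l, p) \<in> ?T" and rest: "steps ?T p w' (n+1)"
      and w: "w = label_word l @ w'"
      using steps_first_edge by fastforce
    from edge assms have "l = None" "p = e_init A \<or> p = n+1"
      by (auto simp: wf_enfa_def enfa_star_def)
    then consider "w = w'" "p = n+1" | "w = w'" "p = e_init A"
      using w by auto
    then show "w \<in> kstar (enfa_lang A)"
    proof cases
      case 1
      then show ?thesis
        using steps_from_sink[OF rest] sink by (simp add: kstar_Nil)
    next
      case 2
      have "\<exists>u v. w' = u @ v \<and> steps (insert (e_final A, None, e_init A) (e_trans A)) (e_init A) u (e_final A)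
          \<and> steps ?T (n+1) v (n+1)"
        by (rule steps_leave_region[OF rest[unfolded 2(2)], where S = "e_states A"])
          (use assms in \<open>auto simp: wf_enfa_def enfa_star_def\<close>)
      then obtain u v where "w' = u @ v" and loop: "steps (insert (e_final A, None, e_init A) (e_trans A)) (e_init A) u (e_final A)"
        and "steps ?T (n+1) v (n+1)"
        by blast
      moreover from steps_loop_decompose[OF loop] obtain u1 u2
        where "u = u1 @ u2" "u1 \<in> enfa_lang A" "u2 \<in> kstar (enfa_lang A)"
        unfolding enfa_lang_def by blast
      moreover have "v = []"
        using steps_from_sink[OF \<open>steps ?T (n+1) v (n+1)\<close>] sink by blast
      ultimately show ?thesis
        using 2(1) kstar_app by simp
    qed
  qed
  have "steps ?T q w (n+1)" if "w \<in> kstar (enfa_lang A)" "q \<in> {n, e_final A}" for q w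
    using that
  proof (induction arbitrary: q rule: kstar.induct)
    case kstar_Nil
    then show ?case
      using steps_edge[of q None "n+1" ?T] by (auto simp: enfa_star_def)
  next
    case (kstar_app u v)
    have enter: "steps ?T q [] (e_init A)"
      using kstar_app.prems steps_edge[of q None "e_init A" ?T] by (auto simp: enfa_star_def)
    have round: "steps ?T (e_init A) u (e_final A)"
      using kstar_app.hyps(1) by (auto simp: enfa_lang_def enfa_star_def elim: steps_mono)
    show ?case
      using steps_trans[OF enter steps_trans[OF round kstar_app.IH]] by simp
  qed
  then show "kstar (enfa_lang A) \<subseteq> enfa_lang (enfa_star n A)"
    by (auto simp: enfa_lang_def enfa_star_def)
qed

lemma thompson_lang: "thompson r n = (A, m) \<Longrightarrow> enfa_lang A = lang r"
proof (induction r arbitrary: n A m)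
  case Zero
  then show ?case
    by (auto simp: enfa_lang_def dest: steps_from_sink)
next
  case One
  then show ?case
    by (auto simp: enfa_lang_def steps_single_edge)
next
  case (Atom a)
  then show ?case
    by (auto simp: enfa_lang_def steps_single_edge)
next
  case (Plus r s)
  obtain A1 m1 B1 k where a: "thompson r (n+2) = (A1, m1)" and b: "thompson s m1 = (B1, k)"
    by (metis surj_pair)
  have wf: "wf_enfa A1" "wf_enfa B1"
    using thompson_wf a b by blast+
  have fresh: "e_states A1 \<inter> e_states B1 = {}"
    "n \<notin> e_states A1 \<union> e_states B1" "n+1 \<notin> e_states A1 \<union> e_states B1"
    using thompson_states_range[OF a] thompson_states_range[OF b] by fastforce+
  have "A = enfa_plus n A1 B1"
    using thompson_Plus_eq[OF a b] Plus.prems by simp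
  then show ?case
    using enfa_lang_plus[OF wf fresh] Plus.IH(1)[OF a] Plus.IH(2)[OF b] by simp
next
  case (Times r s)
  obtain A1 m1 B1 k where a: "thompson r n = (A1, m1)" and b: "thompson s m1 = (B1, k)"
    by (metis surj_pair)
  have wf: "wf_enfa A1" "wf_enfa B1"
    using thompson_wf a b by blast+
  have fresh: "e_states A1 \<inter> e_states B1 = {}"
    using thompson_states_range[OF a] thompson_states_range[OF b] by fastforce
  have "A = enfa_times A1 B1"
    using thompson_Times_eq[OF a b] Times.prems by simp
  then show ?case
    using enfa_lang_times[OF wf fresh] Times.IH(1)[OF a] Times.IH(2)[OF b] by simp
next
  case (Star r)
  obtain A1 m1 where a: "thompson r (n+2) = (A1, m1)"
    by (metis surj_pair)
  have wf: "wf_enfa A1"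
    using thompson_wf a by blast
  have fresh: "n \<notin> e_states A1" "n+1 \<notin> e_states A1"
    using thompson_states_range[OF a] by fastforce+
  have "A = enfa_star n A1"
    using thompson_Star_eq[OF a] Star.prems by simp
  then show ?case
    using enfa_lang_star[OF wf fresh] Star.IH[OF a] by simp
qed

section \<open>\<open>\<epsilon>\<close>-elimination\<close>

fun nfa_accepts :: "('s, 'a) nfa \<Rightarrow> 's \<Rightarrow> 'a list \<Rightarrow> bool" where
  "nfa_accepts N q [] \<longleftrightarrow> q \<in> n_states N \<and> q \<in> n_final N"
| "nfa_accepts N q (\<sigma> # w) \<longleftrightarrow>
     q \<in> n_states N \<and> (\<exists>q'. (q, \<sigma>, q') \<in> n_trans N \<and> nfa_accepts N q' w)"

lemma nfa_accepts_eps_elim: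
  assumes "wf_enfa A" "p \<in> e_states A"
  shows "nfa_accepts (eps_elim A) p w \<longleftrightarrow> steps (e_trans A) p w (e_final A)"
  using assms(2)
proof (induction w arbitrary: p)
  case Nil
  then show ?case
    by (simp add: eps_elim_def eps_rel_def steps_Nil_iff)
next
  case (Cons \<sigma> w)
  have "q \<in> e_states A" if "(p', Some \<sigma>, q) \<in> e_trans A" for p' q
    using assms(1) that by (auto simp: wf_enfa_def)
  then show ?case
    using Cons by (simp add: eps_elim_def eps_rel_def steps_Cons_iff) blast
qed

lemma nfa_accepts_re_to_nfa:
  "nfa_accepts (re_to_nfa r) (e_init (fst (thompson r 0))) w \<longleftrightarrow> w \<in> lang r"
proof -
  obtain A m where a: "thompson r 0 = (A, m)"
    by (metis surj_pair)
  then have "wf_enfa A"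
    using thompson_wf by blast
  moreover have "w \<in> lang r \<longleftrightarrow> steps (e_trans A) (e_init A) w (e_final A)"
    using thompson_lang[OF a] by (auto simp: enfa_lang_def)
  ultimately show ?thesis
    using nfa_accepts_eps_elim[of A "e_init A" w] by (simp add: re_to_nfa_def a wf_enfa_def)
qed

lemma finite_re_to_nfa_successors: "finite {q'. (q, \<sigma>, q') \<in> n_trans (re_to_nfa r)}"
proof -
  obtain A m where a: "thompson r 0 = (A, m)"
    by (metis surj_pair)
  have "{q'. (q, \<sigma>, q') \<in> n_trans (re_to_nfa r)} \<subseteq> (\<lambda>(_, _, t). t) ` e_trans A"
    by (force simp: re_to_nfa_def eps_elim_def a)
  moreover have "finite (e_trans A)"
    using thompson_wf[OF a] by (simp add: wf_enfa_def)
  ultimately show ?thesis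
    by (rule finite_subset[OF _ finite_imageI])
qed

section \<open>Boolean finite automata\<close>

lemma beval_bdisj: "finite S \<Longrightarrow> beval v (bdisj S) \<longleftrightarrow> (\<exists>q \<in> S. v q)"
proof -
  have "beval v (foldr (\<lambda>q f. BOr (BVar q) f) xs BFalse) \<longleftrightarrow> (\<exists>q \<in> set xs. v q)" for xs
    by (induction xs) auto
  then show "finite S \<Longrightarrow> ?thesis"
    by (simp add: bdisj_def)
qed

lemma beval_map_bexp: "beval v (map_bexp f e) = beval (v \<circ> f) e"
  by (induction e) auto

text \<open>Substituting the transition formulas into the initial formula and then evaluating under
  the final assignment is the same as evaluating the initial formula under the valuation computed
  right to left along the word. Bits outside b_states are False, as in the transition system.\<close>
fun bfa_val :: "('q, 'a) bfa \<Rightarrow> 'a list \<Rightarrow> 'q \<Rightarrow> bool" where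
  "bfa_val B [] q \<longleftrightarrow> q \<in> b_states B \<and> b_fin B q"
| "bfa_val B (\<sigma> # w) q \<longleftrightarrow> q \<in> b_states B \<and> beval (bfa_val B w) (b_trans B q \<sigma>)"

definition bfa_accepts :: "('q, 'a) bfa \<Rightarrow> 'a list \<Rightarrow> bool" where
  "bfa_accepts B w \<longleftrightarrow> beval (bfa_val B w) (b_init B)"

lemma bfa_val_nfa_to_bfa:
  assumes "\<And>q \<sigma>. finite {q'. (q, \<sigma>, q') \<in> n_trans N}"
  shows "bfa_val (nfa_to_bfa N) w q \<longleftrightarrow> nfa_accepts N q w"
  by (induction w arbitrary: q) (auto simp: nfa_to_bfa_def beval_bdisj assms)

lemma bfa_accepts_re_to_nfa: "bfa_accepts (nfa_to_bfa (re_to_nfa r)) w \<longleftrightarrow> w \<in> lang r"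
proof -
  have "b_init (nfa_to_bfa (re_to_nfa r)) = bdisj {e_init (fst (thompson r 0))}"
    by (simp add: nfa_to_bfa_def re_to_nfa_def eps_elim_def)
  then show ?thesis
    by (simp add: bfa_accepts_def beval_bdisj bfa_val_nfa_to_bfa[OF finite_re_to_nfa_successors]
        nfa_accepts_re_to_nfa)
qed

lemma bfa_val_lift: "bfa_val (bfa_lift B) w \<circ> Base = bfa_val B w"
proof (induction w)
  case (Cons \<sigma> w)
  have "Base q \<in> b_states (bfa_lift B) \<longleftrightarrow> q \<in> b_states B"
    "b_trans (bfa_lift B) (Base q) \<sigma> = map_bexp Base (b_trans B q \<sigma>)" for q
    by (auto simp: bfa_lift_def)
  then show ?case
    by (simp add: fun_eq_iff beval_map_bexp Cons.IH)
qed (auto simp: bfa_lift_def)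

lemma bfa_accepts_lift: "bfa_accepts (bfa_lift B) w \<longleftrightarrow> bfa_accepts B w"
proof -
  have "b_init (bfa_lift B) = map_bexp Base (b_init B)"
    by (simp add: bfa_lift_def)
  then show ?thesis
    by (simp add: bfa_accepts_def beval_map_bexp bfa_val_lift)
qed

lemma bfa_val_dunion:
  "bfa_val (bfa_dunion B\<^sub>1 B\<^sub>2 I) w \<circ> InL = bfa_val B\<^sub>1 w"
  "bfa_val (bfa_dunion B\<^sub>1 B\<^sub>2 I) w \<circ> InR = bfa_val B\<^sub>2 w"
  by (induction w) (auto simp: bfa_dunion_def beval_map_bexp)

lemma b_init_bfa_dunion: "b_init (bfa_dunion B\<^sub>1 B\<^sub>2 I) = I"
  by (simp add: bfa_dunion_def)

lemma bfa_accepts_union: "bfa_accepts (bfa_union B\<^sub>1 B\<^sub>2) w \<longleftrightarrow> bfa_accepts B\<^sub>1 w \<or> bfa_accepts B\<^sub>2 w"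
  by (simp add: bfa_accepts_def bfa_union_def b_init_bfa_dunion beval_map_bexp bfa_val_dunion)

lemma bfa_accepts_inter: "bfa_accepts (bfa_inter B\<^sub>1 B\<^sub>2) w \<longleftrightarrow> bfa_accepts B\<^sub>1 w \<and> bfa_accepts B\<^sub>2 w"
  by (simp add: bfa_accepts_def bfa_inter_def b_init_bfa_dunion beval_map_bexp bfa_val_dunion)

lemma bfa_accepts_compl: "bfa_accepts (bfa_compl B) w \<longleftrightarrow> \<not> bfa_accepts B w"
proof -
  have "bfa_val (bfa_compl B) w = bfa_val B w"
    by (induction w) (auto simp: bfa_compl_def)
  then show ?thesis
    by (simp add: bfa_accepts_def bfa_compl_def)
qed

lemma bfa_accepts_smt_to_bfa: "bfa_accepts (smt_to_bfa \<phi>) w \<longleftrightarrow> smt_sat \<phi> w"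
  by (induction \<phi>) (simp_all add: bfa_accepts_lift bfa_accepts_re_to_nfa bfa_accepts_union
      bfa_accepts_inter bfa_accepts_compl)

section \<open>The transition system of a BFA\<close>

lemma bfa_val_outside_states: "q \<notin> b_states B \<Longrightarrow> \<not> bfa_val B w q"
  by (cases w) auto

lemma bfa_to_ts_not_property_iff:
  "\<not> snd (bfa_to_ts B) v \<longleftrightarrow> (\<forall>q \<in> b_states B. v q \<longleftrightarrow> b_fin B q)"
  by (auto simp: bfa_to_ts_def)

lemma ts_path_bfa_to_ts_bfa_val:
  "ts_path (fst (bfa_to_ts B)) w (\<lambda>k. bfa_val B (drop k w)) \<longleftrightarrow> bfa_accepts B w"
proof -
  have "ts_trans (fst (bfa_to_ts B)) (bfa_val B (drop k w)) (w ! k) (bfa_val B (drop (Suc k) w))"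
    if "k < length w" for k
    using that by (simp add: bfa_to_ts_def Cons_nth_drop_Suc[symmetric])
  then show ?thesis
    by (auto simp: ts_path_def ts_state_def bfa_to_ts_def bfa_accepts_def bfa_val_outside_states)
qed

lemma bfa_to_ts_cex_states:
  assumes path: "ts_path (fst (bfa_to_ts B)) w vs"
    and violation: "\<not> snd (bfa_to_ts B) (vs (length w))"
    and "k \<le> length w"
  shows "vs k = bfa_val B (drop k w)"
proof -
  have outside: "\<not> vs k q" if "k \<le> length w" "q \<notin> b_states B" for k q
    using path that by (simp add: ts_path_def ts_state_def bfa_to_ts_def)
  show ?thesis
    using \<open>k \<le> length w\<close>
  proof (induction k rule: inc_induct)
    case base
    show ?case
    proof
      fix q
      show "vs (length w) q = bfa_val B (drop (length w) w) q"
        using violation outside[of "length w" q] by (auto simp: bfa_to_ts_not_property_iff)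
    qed
  next
    case (step k)
    have "vs k q \<longleftrightarrow> beval (vs (Suc k)) (b_trans B q (w ! k))" if "q \<in> b_states B" for q
      using path step.hyps that by (simp add: ts_path_def bfa_to_ts_def)
    moreover have "drop k w = w ! k # drop (Suc k) w"
      using step.hyps by (simp add: Cons_nth_drop_Suc)
    ultimately show ?case
      using outside[of k] step by (auto simp: fun_eq_iff)
  qed
qed

lemma is_cex_bfa_to_ts: "is_cex (fst (bfa_to_ts B)) (snd (bfa_to_ts B)) w \<longleftrightarrow> bfa_accepts B w"
proof
  assume "is_cex (fst (bfa_to_ts B)) (snd (bfa_to_ts B)) w"
  then obtain vs where path: "ts_path (fst (bfa_to_ts B)) w vs"
    and "\<not> snd (bfa_to_ts B) (vs (length w))"
    by (auto simp: is_cex_def)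
  then have "vs 0 = bfa_val B w"
    using bfa_to_ts_cex_states[of B w vs 0] by simp
  with path show "bfa_accepts B w"
    by (simp add: ts_path_def bfa_to_ts_def bfa_accepts_def)
next
  assume "bfa_accepts B w"
  then have "ts_path (fst (bfa_to_ts B)) w (\<lambda>k. bfa_val B (drop k w))"
    by (simp add: ts_path_bfa_to_ts_bfa_val)
  moreover have "\<not> snd (bfa_to_ts B) (bfa_val B (drop (length w) w))"
    by (simp add: bfa_to_ts_not_property_iff)
  ultimately show "is_cex (fst (bfa_to_ts B)) (snd (bfa_to_ts B)) w"
    unfolding is_cex_def by blast
qed

theorem mainTheorem2:
  fixes \<phi> :: "'a::finite smt" and T :: "(sloc, 'a) ts" and P :: "(sloc \<Rightarrow> bool) \<Rightarrow> bool"
  assumes "(T, P) = bfa_to_ts (smt_to_bfa \<phi>)"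
  shows "(\<forall>w. smt_sat \<phi> w \<longleftrightarrow> is_cex T P w) \<and> ((\<exists>w. smt_sat \<phi> w) \<longleftrightarrow> \<not> ts_valid T P)"
proof -
  have "T = fst (bfa_to_ts (smt_to_bfa \<phi>))" "P = snd (bfa_to_ts (smt_to_bfa \<phi>))"
    using assms by (metis fst_conv, metis snd_conv)
  then have "smt_sat \<phi> w \<longleftrightarrow> is_cex T P w" for w
    by (simp add: is_cex_bfa_to_ts bfa_accepts_smt_to_bfa)
  moreover have "\<not> ts_valid T P \<longleftrightarrow> (\<exists>w. is_cex T P w)"
    by (auto simp: ts_valid_def is_cex_def)
  ultimately show ?thesis
    by blast
qed

end
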